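(* Let $X$ be a graph (simple, reflexive, possibly infinite), regarded as a pretopological space with its canonical structure. Then $X$ and its intermediate geometric realization $\mathbf R(X)$ are strongly homotopy equivalent, i.e. there are continuous maps $f:X\to\mathbf R(X)$ and $g:\mathbf R(X)\to X$ with $g\circ f\simeq \mathrm{Id}_X$ and $f\circ g\simeq \mathrm{Id}_{\mathbf R(X)}$.
   Context: Pretopological spaces. A pretopological space is a set $Z$ with, for each $z\in Z$, a filter $\mathcal U_z$ on $Z$ (the neighborhood filter) all of whose members contain $z$; a filter converges to $z$ iff it contains $\mathcal U_z$. A map $f:Z\to W$ is continuous iff $\mathcal U_{f(z)}\subset f(\mathcal U_z)$ for all $z$, where $f(\mathcal U_z)$ is the filter generated by images. Topological spaces are pretopological via their neighborhood filters. In a product a filter converges iff both projections converge (so $\mathcal U_{(z,w)}$ is generated by $A\times B$, $A\in\mathcal U_z$, $B\in\mathcal U_w$). Continuous $f,g:Z\to W$ are homotopic ($f\simeq g$) if there is a continuous $H:Z\times[0,1]\to W$ with $H(\cdot,0)=f$ and $H(\cdot,1)=g$. Graphs. A graph $(X,E)$ is undirected, without multiple edges, and reflexive. Put $c_X(x)=\{y: (x,y)\in E\}$. The canonical pretopology on $X$ has $\mathcal U_x$ = all supersets of $c_X(x)$ in $X$. The clique complex $\mathbf K(X)$ has as simplices the finite nonempty sets of pairwise adjacent vertices; $|\mathbf K(X)|$ is its geometric realization with the usual (weak) topology, with underlying set $\mathrm U|X|\supset X$; $|\sigma|$ denotes the closed geometric simplex of $\sigma$. The intermediate geometric realization $\mathbf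 R(X)$ is the pretopological space on the set $\mathrm U|X|$ where the neighborhood filter at a vertex $v\in X$ is the filter of all supersets of $\bigcup\{|\sigma| : \sigma\in\mathbf K(X),\ v\in\sigma\}$, and the neighborhood filter at a point of $\mathrm U|X|\setminus X$ is its neighborhood filter in $|\mathbf K(X)|$. *)

theory Defs
  imports "HOL-Analysis.Analysis"
begin

text \<open>
  A filter on the carrier \<open>Z\<close> is represented by a filter on the ambient type
  below \<^term>\<open>principal Z\<close>.  The order on the type \<open>filter\<close> is the reverse of the inclusion of
  filters as families of sets: \<open>F \<le> G\<close> says that every member of \<open>G\<close> is a member of \<open>F\<close>.
\<close>

record 'a pretop =
  points :: "'a set"
  nbhd :: "'a \<Rightarrow> 'a filter"

definition pretopological_space :: "'a pretop \<Rightarrow> bool" where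
  "pretopological_space Z \<longleftrightarrow>
     (\<forall>z\<in>points Z. nbhd Z z \<le> principal (points Z) \<and> (\<forall>P. eventually P (nbhd Z z) \<longrightarrow> P z))"

definition pretop_continuous :: "'a pretop \<Rightarrow> 'b pretop \<Rightarrow> ('a \<Rightarrow> 'b) \<Rightarrow> bool" where
  "pretop_continuous Z W f \<longleftrightarrow>
     f \<in> points Z \<rightarrow> points W \<and>
     (\<forall>z\<in>points Z. filtermap f (nbhd Z z) \<le> nbhd W (f z))"

definition pretop_of :: "'a topology \<Rightarrow> 'a pretop" where
  "pretop_of T = \<lparr>points = topspace T, nbhd = nhdsin T\<rparr>"

definition pretop_prod :: "'a pretop \<Rightarrow> 'b pretop \<Rightarrow> ('a \<times> 'b) pretop" where
  "pretop_prod Z W =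
     \<lparr>points = points Z \<times> points W, nbhd = (\<lambda>(z, w). nbhd Z z \<times>\<^sub>F nbhd W w)\<rparr>"

definition pretop_homotopic :: "'a pretop \<Rightarrow> 'b pretop \<Rightarrow> ('a \<Rightarrow> 'b) \<Rightarrow> ('a \<Rightarrow> 'b) \<Rightarrow> bool" where
  "pretop_homotopic Z W f g \<longleftrightarrow>
     pretop_continuous Z W f \<and> pretop_continuous Z W g \<and>
     (\<exists>H. pretop_continuous (pretop_prod Z (pretop_of (top_of_set {0..1::real}))) W H \<and>
          (\<forall>z\<in>points Z. H (z, 0) = f z \<and> H (z, 1) = g z))"

definition strongly_homotopy_equivalent :: "'a pretop \<Rightarrow> 'b pretop \<Rightarrow> bool" where
  "strongly_homotopy_equivalent Z W \<longleftrightarrow>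
     (\<exists>f g. pretop_continuous Z W f \<and> pretop_continuous W Z g \<and>
            pretop_homotopic Z Z (g \<circ> f) id \<and> pretop_homotopic W W (f \<circ> g) id)"


definition reflexive_graph :: "'a set \<Rightarrow> ('a \<times> 'a) set \<Rightarrow> bool" where
  "reflexive_graph X E \<longleftrightarrow> E \<subseteq> X \<times> X \<and> refl_on X E \<and> sym E"

definition graph_pretop :: "'a set \<Rightarrow> ('a \<times> 'a) set \<Rightarrow> 'a pretop" where
  "graph_pretop X E = \<lparr>points = X, nbhd = (\<lambda>x. principal (E `` {x}))\<rparr>"


definition clique_complex :: "'a set \<Rightarrow> ('a \<times> 'a) set \<Rightarrow> 'a set set" where
  "clique_complex X E = {\<sigma>. finite \<sigma> \<and> \<sigma> \<noteq> {} \<and> \<sigma> \<subseteq> X \<and> \<sigma> \<times> \<sigma> \<subseteq> E}"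

text \<open>
  Points of the realization are given by their barycentric coordinates, and a vertex \<open>v\<close> is
  identified with \<^term>\<open>indicator {v} :: 'a \<Rightarrow> real\<close>.
\<close>

definition geometric_simplex :: "'a set \<Rightarrow> ('a \<Rightarrow> real) set" where
  "geometric_simplex \<sigma> =
     {t. (\<forall>u. 0 \<le> t u) \<and> (\<forall>u. u \<notin> \<sigma> \<longrightarrow> t u = 0) \<and> (\<Sum>u\<in>\<sigma>. t u) = 1}"

definition vertex_point :: "'a \<Rightarrow> 'a \<Rightarrow> real" where
  "vertex_point v = indicator {v}"

definition realization_points :: "'a set set \<Rightarrow> ('a \<Rightarrow> real) set" where
  "realization_points K = (\<Union>\<sigma>\<in>K. geometric_simplex \<sigma>)"

text \<open>
  On \<^term>\<open>geometric_simplex \<sigma>\<close> with \<open>\<sigma>\<close> finite, the subspace topology induced by the product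
  topology of the type \<open>'a \<Rightarrow> real\<close> is the Euclidean topology, since all coordinates
  outside \<open>\<sigma>\<close> vanish there.
\<close>

definition realization_open :: "'a set set \<Rightarrow> ('a \<Rightarrow> real) set \<Rightarrow> bool" where
  "realization_open K U \<longleftrightarrow>
     U \<subseteq> realization_points K \<and>
     (\<forall>\<sigma>\<in>K. openin (top_of_set (geometric_simplex \<sigma>)) (U \<inter> geometric_simplex \<sigma>))"

definition geometric_realization :: "'a set set \<Rightarrow> ('a \<Rightarrow> real) topology" where
  "geometric_realization K = topology (realization_open K)"

lemma istopology_realization_open: "istopology (realization_open K)"
  unfolding istopology_def
proof (intro conjI allI impI)
  fix S T assume ST: "realization_open K S" "realization_open K T"
  have "openin (top_of_set A) (S \<inter> T \<inter> A)"
    if "openin (top_of_set A) (S \<inter> A)" "openin (top_of_set A) (T \<inter> A)" for A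
    using openin_Int[OF that] by (simp add: Int_ac)
  with ST show "realization_open K (S \<inter> T)"
    unfolding realization_open_def by blast
next
  fix \<K> assume *: "\<forall>S\<in>\<K>. realization_open K S"
  have "openin (top_of_set A) (\<Union>\<K> \<inter> A)"
    if "\<forall>S\<in>\<K>. openin (top_of_set A) (S \<inter> A)" for A
  proof -
    have "\<Union>\<K> \<inter> A = \<Union>((\<lambda>S. S \<inter> A) ` \<K>)" by blast
    then show ?thesis using that by (metis (no_types, lifting) imageE openin_Union)
  qed
  with * show "realization_open K (\<Union>\<K>)"
    unfolding realization_open_def by blast
qed

lemma openin_geometric_realization:
  "openin (geometric_realization K) U \<longleftrightarrow> realization_open K U"
  by (simp add: geometric_realization_def topology_inverse' istopology_realization_open)

lemma topspace_geometric_realization: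
  "topspace (geometric_realization K) = realization_points K"
proof -
  have "realization_open K (realization_points K)"
    unfolding realization_open_def realization_points_def
    by (auto simp: Int_absorb1 UN_upper)
  then show ?thesis
    unfolding topspace_def openin_geometric_realization
    by (auto simp: realization_open_def)
qed


definition closed_star :: "'a set set \<Rightarrow> 'a \<Rightarrow> ('a \<Rightarrow> real) set" where
  "closed_star K v = \<Union>{geometric_simplex \<sigma> | \<sigma>. \<sigma> \<in> K \<and> v \<in> \<sigma>}"

text \<open>In the first case below the vertex \<open>v\<close> with \<open>t = vertex_point v\<close> is unique.\<close>

definition intermediate_realization :: "'a set \<Rightarrow> ('a \<times> 'a) set \<Rightarrow> ('a \<Rightarrow> real) pretop" where
  "intermediate_realization X E =
     \<lparr>points = realization_points (clique_complex X E),
      nbhd = (\<lambda>t.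
        if t \<in> vertex_point ` X
        then principal (closed_star (clique_complex X E) (THE v. t = vertex_point v))
        else nhdsin (geometric_realization (clique_complex X E)) t)\<rparr>"


lemma inj_vertex_point: "vertex_point v = vertex_point w \<longleftrightarrow> v = w"
  by (metis indicator_simps(1) indicator_simps(2) singletonD singletonI vertex_point_def
      zero_neq_one)

lemma the_vertex_point: "(THE u. vertex_point v = vertex_point u) = v"
  by (simp add: inj_vertex_point)

lemma vertex_point_in_simplex:
  "finite \<sigma> \<Longrightarrow> v \<in> \<sigma> \<Longrightarrow> vertex_point v \<in> geometric_simplex \<sigma>"
  by (auto simp: geometric_simplex_def vertex_point_def indicator_def of_bool_def sum.delta)

lemma pretopological_space_pretop_of: "pretopological_space (pretop_of T)"
  by (auto simp: pretopological_space_def pretop_of_def eventually_nhdsin le_principal)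

lemma pretopological_space_prod:
  assumes "pretopological_space Z" "pretopological_space W"
  shows "pretopological_space (pretop_prod Z W)"
proof -
  have "nbhd Z z \<times>\<^sub>F nbhd W w \<le> principal (points Z \<times> points W)"
    if "z \<in> points Z" "w \<in> points W" for z w
    using assms that prod_filter_mono[of "nbhd Z z" "principal (points Z)" "nbhd W w"
        "principal (points W)"]
    by (simp add: pretopological_space_def principal_prod_principal)
  moreover have "P (z, w)"
    if "z \<in> points Z" "w \<in> points W" "eventually P (nbhd Z z \<times>\<^sub>F nbhd W w)" for z w P
    using assms that unfolding pretopological_space_def eventually_prod_filter by blast
  ultimately show ?thesis
    by (auto simp: pretopological_space_def pretop_prod_def)
qed

lemma pretopological_space_graph:
  "reflexive_graph X E \<Longrightarrow> pretopological_space (graph_pretop X E)"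
  by (auto simp: pretopological_space_def graph_pretop_def reflexive_graph_def refl_on_def
      eventually_principal)

lemma pretopological_space_intermediate_realization:
  assumes "reflexive_graph X E"
  shows "pretopological_space (intermediate_realization X E)"
proof -
  let ?K = "clique_complex X E"
  have star: "closed_star ?K v \<subseteq> realization_points ?K" for v
    by (auto simp: closed_star_def realization_points_def)
  have centre: "vertex_point v \<in> closed_star ?K v" if "v \<in> X" for v
  proof -
    have "{v} \<in> ?K" using that assms
      by (auto simp: clique_complex_def reflexive_graph_def refl_on_def)
    moreover have "vertex_point v \<in> geometric_simplex {v}"
      by (simp add: vertex_point_in_simplex)
    ultimately show ?thesis unfolding closed_star_def by blast
  qed
  show ?thesis
    using star centre
    by (auto simp: pretopological_space_def intermediate_realization_def the_vertex_point
        eventually_principal eventually_nhdsin le_principal topspace_geometric_realization)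
qed

end

theory Submission
  imports Defs
begin

text \<open>
  Let \<open>f\<close> send a vertex to itself and let \<open>g\<close> send a point of the realization to some vertex of
  its support.  Then \<open>g \<circ> f\<close> is the identity, and near every point \<open>t\<close> all points lie in the
  closed star of \<open>g t\<close>, because the open star of \<open>g t\<close> is a neighbourhood of \<open>t\<close>.  Since the
  closed star is the smallest neighbourhood of a vertex, the map that is \<open>f \<circ> g\<close> at time \<open>0\<close>
  and the identity at all later times is already continuous.
\<close>

lemma pretop_continuous_compose:
  assumes "pretop_continuous Z W f" "pretop_continuous W V g"
  shows "pretop_continuous Z V (g \<circ> f)"
proof -
  have "filtermap (g \<circ> f) (nbhd Z z) \<le> nbhd V (g (f z))" if "z \<in> points Z" for z
  proof -
    have "filtermap g (filtermap f (nbhd Z z)) \<le> filtermap g (nbhd W (f z))"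
      using assms(1) that by (intro filtermap_mono) (simp add: pretop_continuous_def)
    also have "\<dots> \<le> nbhd V (g (f z))"
      using assms that by (auto simp: pretop_continuous_def)
    finally show ?thesis by (simp add: filtermap_filtermap comp_def)
  qed
  then show ?thesis
    using assms by (auto simp: pretop_continuous_def)
qed

lemma pretop_continuous_id: "pretop_continuous Z Z id"
  by (simp add: pretop_continuous_def filtermap_id)

text \<open>The homotopy leaves \<open>f\<close> immediately after time 0. Only times near 0 are
  delicate: there \<open>g\<close> must carry points near \<open>z\<close> into every neighbourhood
  of \<open>f z\<close>, which is the third assumption.\<close>

lemma pretop_homotopic_jump:
  assumes f: "pretop_continuous Z W f" and g: "pretop_continuous Z W g"
    and fg: "\<And>z. z \<in> points Z \<Longrightarrow> filtermap g (nbhd Z z) \<le> nbhd W (f z)"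
  shows "pretop_homotopic Z W f g"
proof -
  let ?I = "top_of_set {0..1::real}"
  define H where "H = (\<lambda>(z, s::real). if s = 0 then f z else g z)"
  have "filtermap H (nbhd Z z \<times>\<^sub>F nhdsin ?I s) \<le> nbhd W (H (z, s))"
    if z: "z \<in> points Z" and s: "s \<in> {0..1}" for z s
  proof (rule filter_leI)
    fix P assume P: "eventually P (nbhd W (H (z, s)))"
    have evf: "eventually (\<lambda>z'. P (f z')) (nbhd Z z)" if "s = 0"
    proof -
      have "filtermap f (nbhd Z z) \<le> nbhd W (H (z, s))"
        using f z that by (simp add: H_def pretop_continuous_def)
      then show ?thesis using P by (simp add: filter_leD flip: eventually_filtermap)
    qed
    \<comment> \<open>At \<open>s = 0\<close> this is \<open>fg\<close>; at \<open>s > 0\<close> it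
      is the continuity of \<open>g\<close>.\<close>
    have "filtermap g (nbhd Z z) \<le> nbhd W (H (z, s))"
      using g fg z by (simp add: H_def pretop_continuous_def)
    then have evg: "eventually (\<lambda>z'. P (g z')) (nbhd Z z)"
      using P by (simp add: filter_leD flip: eventually_filtermap)
    show "eventually P (filtermap H (nbhd Z z \<times>\<^sub>F nhdsin ?I s))"
    proof (cases "s = 0")
      case True
      \<comment> \<open>Around \<open>(z, 0)\<close> the map \<open>H\<close> takes values of both
        \<open>f\<close> and \<open>g\<close>, so one neighbourhood of \<open>z\<close> has to serve
        both.\<close>
      have "eventually (\<lambda>z'. P (f z') \<and> P (g z')) (nbhd Z z)"
        using evf[OF True] evg by (rule eventually_conj)
      then show ?thesis
        unfolding eventually_filtermap eventually_prod_filter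
        by (intro exI[of _ "\<lambda>z'. P (f z') \<and> P (g z')"] exI[of _ "\<lambda>_. True"])
          (auto simp: H_def)
    next
      case False
      \<comment> \<open>The positive times form a neighbourhood of \<open>s\<close> on which
        \<open>H\<close> agrees with \<open>g\<close>.\<close>
      have "openin ?I ({0..1} \<inter> {0<..})"
        by (simp add: openin_open_Int)
      then have "eventually (\<lambda>s'. s' \<noteq> 0) (nhdsin ?I s)"
        using False s by (auto simp: eventually_nhdsin intro!: exI[of _ "{0..1} \<inter> {0<..}"])
      then show ?thesis
        using evg unfolding eventually_filtermap eventually_prod_filter
        by (intro exI[of _ "\<lambda>z'. P (g z')"] exI[of _ "\<lambda>s'. s' \<noteq> 0"]) (auto simp: H_def)
    qed
  qed
  moreover have "H (z, s) \<in> points W" if "z \<in> points Z" for z s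
    using f g that by (auto simp: H_def pretop_continuous_def)
  ultimately have "pretop_continuous (pretop_prod Z (pretop_of ?I)) W H"
    by (auto simp: pretop_continuous_def pretop_prod_def pretop_of_def)
  then show ?thesis
    using f g unfolding pretop_homotopic_def by (auto simp: H_def)
qed

lemma in_closed_star_if_coordinate_nonzero:
  assumes "t \<in> realization_points K" "t v \<noteq> 0"
  shows "t \<in> closed_star K v"
  using assms unfolding realization_points_def closed_star_def geometric_simplex_def by blast

lemma geometric_simplex_coordinate_nonzero:
  assumes "t \<in> geometric_simplex \<sigma>"
  shows "\<exists>u. t u \<noteq> 0"
proof (rule ccontr)
  assume "\<nexists>u. t u \<noteq> 0"
  then show False using assms by (simp add: geometric_simplex_def)
qed

text \<open>This set is the open star of \<open>v\<close>. In the weak topology openness is tested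
  on each simplex, where evaluation at \<open>v\<close> is continuous.\<close>

lemma openin_geometric_realization_coordinate:
  "openin (geometric_realization K) {t \<in> realization_points K. t v \<noteq> 0}"
proof -
  have "open {t :: 'a \<Rightarrow> real. t v \<noteq> 0}"
    by (intro open_Collect_neq continuous_intros) auto
  then have "openin (top_of_set (geometric_simplex \<sigma>)) (geometric_simplex \<sigma> \<inter> {t. t v \<noteq> 0})" for \<sigma>
    by (rule openin_open_Int)
  moreover have "{t \<in> realization_points K. t v \<noteq> 0} \<inter> geometric_simplex \<sigma> =
      geometric_simplex \<sigma> \<inter> {t. t v \<noteq> 0}" if "\<sigma> \<in> K" for \<sigma>
    using that by (auto simp: realization_points_def)
  ultimately show ?thesis
    by (auto simp: openin_geometric_realization realization_open_def)
qed

text \<open>If \<open>t\<close> is a vertex, its only nonzero coordinate is its own, so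
  \<open>t\<close> is the vertex \<open>v\<close> and the closed star generates its filter.
  Otherwise the open star of \<open>v\<close> is a neighbourhood of \<open>t\<close> inside the
  closed star.\<close>

lemma eventually_in_closed_star:
  assumes "t \<in> realization_points (clique_complex X E)" "t v \<noteq> 0"
  shows "eventually (\<lambda>s. s \<in> closed_star (clique_complex X E) v)
    (nbhd (intermediate_realization X E) t)"
proof (cases "t \<in> vertex_point ` X")
  case True
  then obtain w where w: "w \<in> X" "t = vertex_point w" by blast
  then have "w = v"
    using assms(2) by (auto simp: vertex_point_def indicator_def split: if_splits)
  then show ?thesis
    using w by (simp add: intermediate_realization_def the_vertex_point eventually_principal)
next
  case False
  have "eventually (\<lambda>s. s \<in> closed_star (clique_complex X E) v)
      (nhdsin (geometric_realization (clique_complex X E)) t)"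
    using assms openin_geometric_realization_coordinate[of "clique_complex X E" v]
    by (auto simp: eventually_nhdsin topspace_geometric_realization
        intro!: in_closed_star_if_coordinate_nonzero
          exI[of _ "{t \<in> realization_points (clique_complex X E). t v \<noteq> 0}"])
  then show ?thesis
    using False by (simp add: intermediate_realization_def)
qed

text \<open>A simplex containing both \<open>v\<close> and \<open>t\<close> has the whole support of
  \<open>t\<close> among its vertices, and its vertices are pairwise adjacent. This gives the
  continuity of \<open>g\<close>.\<close>

lemma clique_complex_closed_star_edge:
  assumes "t \<in> closed_star (clique_complex X E) v" "t u \<noteq> 0"
  shows "(v, u) \<in> E"
proof -
  obtain \<sigma> where "\<sigma> \<times> \<sigma> \<subseteq> E" "v \<in> \<sigma>" "t \<in> geometric_simplex \<sigma>"
    using assms(1) by (auto simp: closed_star_def clique_complex_def)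
  moreover have "u \<in> \<sigma>"
    using assms(2) calculation(3) by (auto simp: geometric_simplex_def)
  ultimately show ?thesis by blast
qed

lemma nbhd_intermediate_realization_vertex:
  "v \<in> X \<Longrightarrow> nbhd (intermediate_realization X E) (vertex_point v) =
     principal (closed_star (clique_complex X E) v)"
  by (simp add: intermediate_realization_def the_vertex_point)

lemma vertex_point_in_closed_star:
  assumes "reflexive_graph X E" "(v, w) \<in> E"
  shows "vertex_point w \<in> closed_star (clique_complex X E) v"
proof -
  have "{v, w} \<in> clique_complex X E"
    using assms by (auto simp: clique_complex_def reflexive_graph_def refl_on_def sym_def)
  moreover have "vertex_point w \<in> geometric_simplex {v, w}"
    by (simp add: vertex_point_in_simplex)
  ultimately show ?thesis unfolding closed_star_def by blast
qed

theorem proposition1p19: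
  fixes X :: "'a set" and E :: "('a \<times> 'a) set"
  assumes "reflexive_graph X E"
  shows "strongly_homotopy_equivalent (graph_pretop X E) (intermediate_realization X E)"
proof -
  let ?G = "graph_pretop X E" and ?R = "intermediate_realization X E"
  let ?K = "clique_complex X E"
  \<comment> \<open>Any choice of support vertex will do: the choices at nearby points are adjacent,
    and the graph asks for no more.\<close>
  define g :: "('a \<Rightarrow> real) \<Rightarrow> 'a" where "g = (\<lambda>t. SOME u. t u \<noteq> 0)"
  have points: "points ?R = realization_points ?K" "points ?G = X"
    by (simp_all add: intermediate_realization_def graph_pretop_def)
  have g_nz: "t (g t) \<noteq> 0" if "t \<in> realization_points ?K" for t
    using that geometric_simplex_coordinate_nonzero unfolding g_def realization_points_def
    by (metis (mono_tags, lifting) UN_E someI_ex)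
  have g_X: "g t \<in> X" if "t \<in> realization_points ?K" for t
    using g_nz[OF that] that
    by (auto simp: realization_points_def clique_complex_def geometric_simplex_def)
  have near: "eventually (\<lambda>s. s \<in> closed_star ?K (g t)) (nbhd ?R t)"
    if "t \<in> realization_points ?K" for t
    by (rule eventually_in_closed_star[OF that g_nz[OF that]])
  have star: "closed_star ?K v \<subseteq> realization_points ?K" for v
    by (auto simp: closed_star_def realization_points_def)

  have f_star: "vertex_point w \<in> closed_star ?K v" if "(v, w) \<in> E" for v w
    using vertex_point_in_closed_star[OF assms that] .
  have "vertex_point v \<in> realization_points ?K" if "v \<in> X" for v
    using f_star[of v v] star that assms by (auto simp: reflexive_graph_def refl_on_def)
  then have f: "pretop_continuous ?G ?R vertex_point"
    using f_star
    by (auto simp: pretop_continuous_def points nbhd_intermediate_realization_vertex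
        graph_pretop_def)

  have "filtermap g (nbhd ?R t) \<le> nbhd ?G (g t)" if t: "t \<in> realization_points ?K" for t
  proof -
    have "(g t, g s) \<in> E" if s: "s \<in> closed_star ?K (g t)" for s
      using clique_complex_closed_star_edge[OF s] g_nz subsetD[OF star s] by simp
    then have "eventually (\<lambda>s. (g t, g s) \<in> E) (nbhd ?R t)"
      using near[OF t] by (rule eventually_mono[rotated])
    then show ?thesis
      by (simp add: graph_pretop_def le_principal eventually_filtermap)
  qed
  then have g: "pretop_continuous ?R ?G g"
    by (auto simp: pretop_continuous_def points g_X)

  \<comment> \<open>A vertex point has a single nonzero coordinate, so the choice is forced.\<close>
  have "g (vertex_point v) = v" for v
    by (simp add: g_def vertex_point_def indicator_def)
  then have gf: "g \<circ> vertex_point = id"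
    by auto
  have "pretop_homotopic ?G ?G (g \<circ> vertex_point) id"
    unfolding gf
    by (rule pretop_homotopic_jump) (simp_all add: pretop_continuous_id filtermap_id)
  moreover have "pretop_homotopic ?R ?R (vertex_point \<circ> g) id"
  proof (rule pretop_homotopic_jump)
    \<comment> \<open>The filter at the vertex \<open>g t\<close> is principal on its closed star,
      so this is exactly \<open>near\<close>.\<close>
    show "filtermap id (nbhd ?R t) \<le> nbhd ?R ((vertex_point \<circ> g) t)" if "t \<in> points ?R" for t
      using that near[of t] g_X[of t]
      by (simp add: points nbhd_intermediate_realization_vertex le_principal filtermap_id)
  qed (use f g in \<open>auto intro: pretop_continuous_compose pretop_continuous_id\<close>)
  ultimately show ?thesis
    using f g unfolding strongly_homotopy_equivalent_def by blast
qed

end
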